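(* Let $p>3$ be a prime. Then the modular variety $\mathcal{F}_{2p^2}$ has at most $160(p^5+p^2)$ boundary curves.
   Context: $U$ is the hyperbolic plane (even unimodular lattice of rank 2 with Gram matrix $\begin{pmatrix}0&1\\1&0\end{pmatrix}$), $\langle m\rangle$ is the rank 1 lattice generated by a vector of square $m$, and $L=U^{\oplus 3}\oplus\langle -6\rangle$. For $x\in L$, $\operatorname{div}(x)$ is the positive generator of the ideal $(x,L)\subset\mathbb{Z}$. A primitive vector $h\in L$ is split if $\operatorname{div}(h)=1$; its degree is $h^2=2d$. For such $h$ with $h^2=2d>0$, $h^\perp\subset L$ is isomorphic to $U^{\oplus 2}\oplus\langle -6\rangle\oplus\langle -2d\rangle$, of signature $(2,4)$. $\operatorname{O}(L,h)=\{g\in \operatorname{O}(L)\mid gh=h\}$, and $\operatorname{O}^+(L,h)$ is the subgroup of elements of real spinor norm $1$, where the real spinor norm is normalised so that its kernel on $\operatorname{O}(h^\perp\otimes\mathbb{R})$ preserves each of the two connected components of $$\Omega_{h^\perp}=\{[x]\in\mathbb{P}(h^\perp\otimes\mathbb{C})\mid (x,x)=0,\ (x,\overline{x})>0\}.$$ Let $\mathcal{D}_{h^\perp}$ be a connected component of $\Omega_{h^\perp}$. The modular variety $\mathcal{F}_{2d}$ is $\operatorname{O}^+(L,h)\backslash\mathcal{D}_{h^\perp}$ with $h\in L$ primitive, split, of degree $2d$. The boundary curves of $\mathcal{F}_{2d}$ are the rational boundary components corresponding to $\operatorname{O}^+(L,h)$-equivalence classes of totally isotropic planes in $h^\perp\otimes\mathbb{Q}$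 (equivalently, of primitive totally isotropic rank 2 sublattices of $h^\perp$). *)

theory Defs
  imports "HOL-Analysis.Analysis" "HOL-Computational_Algebra.Primes"
begin

text \<open>
  The lattice L = U + U + U + <-6> is the group \<open>int ^ 7\<close> with the bilinear form below.  The form is
  polymorphic in the ring of coefficients, so that the same formula gives the form on the
  extensions of scalars of L to the rationals and to the reals.
\<close>

definition bil :: "'a::comm_ring_1 ^ 7 \<Rightarrow> 'a ^ 7 \<Rightarrow> 'a" where
  "bil x y = (x$1 * y$2 + x$2 * y$1) + (x$3 * y$4 + x$4 * y$3) + (x$5 * y$6 + x$6 * y$5)
     - 6 * (x$7 * y$7)"

definition ext_vec :: "int ^ 7 \<Rightarrow> 'a::comm_ring_1 ^ 7" where
  "ext_vec x = (\<chi> i. of_int (x $ i))"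

definition ext_map :: "int ^ 7 ^ 7 \<Rightarrow> 'a::comm_ring_1 ^ 7 \<Rightarrow> 'a ^ 7" where
  "ext_map g x = map_matrix of_int g *v x"

definition lattice_div :: "int ^ 7 \<Rightarrow> int" where
  "lattice_div x = Gcd (range (bil x))"

definition primitive :: "int ^ 7 \<Rightarrow> bool" where
  "primitive x \<longleftrightarrow> (\<forall>m y. x = m *s y \<longrightarrow> is_unit m)"

definition split_vec :: "int ^ 7 \<Rightarrow> bool" where
  "split_vec h \<longleftrightarrow> primitive h \<and> lattice_div h = 1"

text \<open>
  For \<open>'a = int\<close>, \<open>rat\<close>, \<open>real\<close> this is the orthogonal complement of h in L, and its extension of
  scalars to the rationals and to the reals.
\<close>

definition perp :: "int ^ 7 \<Rightarrow> ('a::comm_ring_1 ^ 7) set" where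
  "perp h = {x. bil (ext_vec h) x = 0}"

definition O_L :: "(int ^ 7 ^ 7) set" where
  "O_L = {g. invertible g \<and> (\<forall>x y. bil (g *v x) (g *v y) = bil x y)}"

definition O_stab :: "int ^ 7 \<Rightarrow> (int ^ 7 ^ 7) set" where
  "O_stab h = {g \<in> O_L. g *v h = h}"

definition reflection :: "real ^ 7 \<Rightarrow> real ^ 7 \<Rightarrow> real ^ 7" where
  "reflection v x = x - (2 * bil x v / bil v v) *\<^sub>R v"

text \<open>
  \<open>has_spinor_norm V g \<epsilon>\<close>: the isometry g of the nondegenerate real quadratic space V has real
  spinor norm \<open>\<epsilon>\<close>.  By the Cartan--Dieudonne theorem g is a product of reflections in
  non-isotropic vectors v of V; its spinor norm is the class of the product of the numbers -(v,v)/2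
  modulo squares of nonzero reals, i.e. the product of their signs, which does not depend on the
  chosen factorisation (so a relation suffices here).

  The sign is the normalisation required for a space of signature (2,n): the reflection in v has
  spinor norm 1 iff (v,v) < 0.  If x = a + i b represents a point of Omega, then (a,b) spans a
  positive definite plane.  A reflection with (v,v) < 0 fixes such a point with a and b orthogonal
  to v, so preserves both components of Omega; a reflection with (v,v) > 0 sends the point
  with a = v to its complex conjugate, so interchanges the two components.
\<close>

definition has_spinor_norm :: "(real ^ 7) set \<Rightarrow> (real ^ 7 \<Rightarrow> real ^ 7) \<Rightarrow> real \<Rightarrow> bool" where
  "has_spinor_norm V g \<epsilon> \<longleftrightarrow>
     (\<exists>vs. (\<forall>v\<in>set vs. v \<in> V \<and> bil v v \<noteq> 0) \<and>
           (\<forall>x\<in>V. g x = foldr reflection vs x) \<and>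
           \<epsilon> = (\<Prod>v\<leftarrow>vs. sgn (- bil v v / 2)))"

definition O_plus :: "int ^ 7 \<Rightarrow> (int ^ 7 ^ 7) set" where
  "O_plus h = {g \<in> O_stab h. has_spinor_norm (perp h) (ext_map g) 1}"

definition isotropic_planes :: "int ^ 7 \<Rightarrow> (rat ^ 7) set set" where
  "isotropic_planes h =
     {E. E \<subseteq> perp h \<and> vec.subspace E \<and> vec.dim E = 2 \<and> (\<forall>x\<in>E. \<forall>y\<in>E. bil x y = 0)}"

definition plane_equiv :: "int ^ 7 \<Rightarrow> ((rat ^ 7) set \<times> (rat ^ 7) set) set" where
  "plane_equiv h =
     {(E, E'). E \<in> isotropic_planes h \<and> E' \<in> isotropic_planes h \<and>
               (\<exists>g\<in>O_plus h. E' = ext_map g ` E)}"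

text \<open>
  The boundary curves of the modular variety of h, i.e. of the quotient of a component of Omega by
  \<open>O_plus h\<close>: a rational boundary component of dimension 1 is given by a totally isotropic
  rational plane, and the boundary curves are the classes of these modulo the group.
\<close>

definition boundary_curves :: "int ^ 7 \<Rightarrow> (rat ^ 7) set set set" where
  "boundary_curves h = isotropic_planes h // plane_equiv h"

end

theory Submission
  imports Defs
begin

text \<open>
  Instead of classifying the isotropic planes in the orthogonal complement of one vector, the proof
  fixes the plane and counts the vectors.  All rational isotropic planes are equivalent under the
  isometries of \<open>L\<close> (\<open>isotropic_plane_transitive\<close>), because primitive isotropic vectors are:
  a transvection version of the Smith normal form moves such a vector to a coordinate vector up to
  sign.  Let \<open>E\<^sub>0\<close> be the plane spanned by \<open>e\<^sub>1\<close> and \<open>e\<^sub>3\<close>.  Then the \<open>O_stab h\<close>-classes of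
  planes in the complement of \<open>h\<close> correspond to the vectors \<open>h'\<close> in the orbit of \<open>h\<close> that are
  orthogonal to \<open>E\<^sub>0\<close>, modulo the stabilizer of \<open>E\<^sub>0\<close> in the isometry group of \<open>L\<close>.

  Such a vector has the form \<open>(a, 0, b, 0, x, y, z)\<close> with \<open>x y - 3 z\<^sup>2 = p\<^sup>2\<close>.  The isometries that fix
  \<open>E\<^sub>0\<close> pointwise allow Gauss reduction of the binary form given by \<open>x, y, z\<close> and
  reduction of \<open>a\<close> and \<open>b\<close> modulo \<open>x\<close>.  The reduced vectors satisfy
  \<open>\<bar>x\<bar> \<le> 2 p\<close>, \<open>\<bar>z\<bar> \<le> p\<close> and \<open>0 \<le> a, b < 2 p\<close>, so there are at most \<open>60 p\<^sup>4\<close> of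
  them (\<open>isotropic_plane_normal_form\<close>, \<open>card_normal_forms\<close>).

  Passing from \<open>O_stab h\<close> to \<open>O_plus h\<close> at most doubles the number of classes.  For this it is
  enough that every element of \<open>O_stab h\<close> has some spinor norm 1 or -1, i.e. is a product of
  reflections on the complement of \<open>h\<close> (\<open>spinor_norm_exists\<close>), and that spinor norms multiply.  The
  resulting bound \<open>120 p\<^sup>4\<close> is smaller than the one claimed.
\<close>

section \<open>The form and its isometries\<close>

lemma bil_commute: "bil x y = bil y x"
  by (simp add: bil_def algebra_simps)

lemma bil_linear [simp]:
  "bil (x + y) z = bil x z + bil y z" "bil z (x + y) = bil z x + bil z y"
  "bil (x - y) z = bil x z - bil y z" "bil z (x - y) = bil z x - bil z y"
  "bil (- x) z = - bil x z" "bil z (- x) = - bil z x"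
  "bil (c *s x) z = c * bil x z" "bil z (c *s x) = c * bil z x"
  "bil 0 z = 0" "bil z 0 = 0"
  by (simp_all add: bil_def algebra_simps)

lemma bil_scaleR [simp]:
  fixes x y :: "real ^ 7"
  shows "bil (c *\<^sub>R x) y = c * bil x y" "bil x (c *\<^sub>R y) = c * bil x y"
  by (simp_all flip: scalar_mult_eq_scaleR)

lemma bil_sum_left: "bil (\<Sum>i\<in>A. f i) y = (\<Sum>i\<in>A. bil (f i) y)"
  by (induction A rule: infinite_finite_induct) simp_all

lemma bil_sum_right: "bil y (\<Sum>i\<in>A. f i) = (\<Sum>i\<in>A. bil y (f i))"
  by (induction A rule: infinite_finite_induct) simp_all

lemma exhaust_7:
  fixes i :: 7
  shows "i = 1 \<or> i = 2 \<or> i = 3 \<or> i = 4 \<or> i = 5 \<or> i = 6 \<or> i = 7"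
proof (induct i)
  case (of_int z)
  then have "0 \<le> z" "z < 7" by simp_all
  then have "z = 0 \<or> z = 1 \<or> z = 2 \<or> z = 3 \<or> z = 4 \<or> z = 5 \<or> z = 6" by arith
  then show ?case by auto
qed

lemma forall_7: "(\<forall>i::7. P i) \<longleftrightarrow> P 1 \<and> P 2 \<and> P 3 \<and> P 4 \<and> P 5 \<and> P 6 \<and> P 7"
  by (metis exhaust_7)

lemma vec7_eq_iff:
  "x = y \<longleftrightarrow> x$1 = y$1 \<and> x$2 = y$2 \<and> x$3 = y$3 \<and> x$4 = y$4 \<and> x$5 = y$5 \<and> x$6 = y$6
    \<and> x$7 = (y :: 'a ^ 7)$7"
  by (simp add: vec_eq_iff forall_7)

abbreviation unit_vec :: "7 \<Rightarrow> 'a::comm_ring_1 ^ 7" where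
  "unit_vec i \<equiv> axis i 1"

lemma axis_nth_if [simp]: "axis i c $ j = (if i = j then c else 0)"
  by (simp add: axis_def)

lemma bil_unit_vec [simp]:
  "bil (unit_vec 1) v = v$2" "bil (unit_vec 2) v = v$1"
  "bil (unit_vec 3) v = v$4" "bil (unit_vec 4) v = v$3"
  "bil (unit_vec 5) v = v$6" "bil (unit_vec 6) v = v$5"
  "bil (unit_vec 7) v = - 6 * v$7"
  by (simp_all add: bil_def)

lemma bil_unit_vec_right [simp]:
  "bil v (unit_vec 1) = v$2" "bil v (unit_vec 2) = v$1"
  "bil v (unit_vec 3) = v$4" "bil v (unit_vec 4) = v$3"
  "bil v (unit_vec 5) = v$6" "bil v (unit_vec 6) = v$5"
  "bil v (unit_vec 7) = - 6 * v$7"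
  by (simp_all add: bil_commute [of v])

lemma matrix_of_linear:
  fixes f :: "'a::comm_ring_1 ^ 'n \<Rightarrow> 'a ^ 'm"
  assumes "\<And>x y. f (x + y) = f x + f y" "\<And>c x. f (c *s x) = c *s f x"
  obtains M where "\<And>x. M *v x = f x"
proof
  fix x
  have zero: "f 0 = 0" using assms(2) [of 0 0] by simp
  have sum: "f (\<Sum>i\<in>A. g i) = (\<Sum>i\<in>A. f (g i))" for g :: "'n \<Rightarrow> 'a ^ 'n" and A
    by (induction A rule: infinite_finite_induct) (simp_all add: zero assms(1))
  have "f x = f (\<Sum>i\<in>UNIV. x $ i *s axis i 1)"
    by (simp add: basis_expansion)
  also have "\<dots> = (\<Sum>i\<in>UNIV. x $ i *s f (axis i 1))"
    by (simp add: sum assms(2))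
  finally show "(\<chi> i j. f (axis j 1) $ i) *v x = f x"
    by (simp add: vec_eq_iff matrix_vector_mult_def mult.commute)
qed

lemma matrix_vector_mult_scale:
  fixes A :: "'a::comm_ring_1 ^ 'n ^ 'm"
  shows "A *v (c *s x) = c *s (A *v x)"
  by (simp add: vec_eq_iff matrix_vector_mult_def sum_distrib_left ac_simps)

text \<open>
  The isometries below are given by formulas.  Exhibiting the inverse map as well shows that the
  matrix is invertible over the integers without computing a determinant.
\<close>

lemma O_L_of_linear:
  fixes f f' :: "int ^ 7 \<Rightarrow> int ^ 7"
  assumes "\<And>x y. f (x + y) = f x + f y" "\<And>c x. f (c *s x) = c *s f x"
    and "\<And>x y. f' (x + y) = f' x + f' y" "\<And>c x. f' (c *s x) = c *s f' x"
    and "\<And>x. f' (f x) = x" "\<And>x. f (f' x) = x"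
    and "\<And>x y. bil (f x) (f y) = bil x y"
  obtains g where "g \<in> O_L" "\<And>x. g *v x = f x"
proof -
  obtain M where M: "\<And>x. M *v x = f x" using matrix_of_linear assms(1,2) by blast
  obtain M' where M': "\<And>x. M' *v x = f' x" using matrix_of_linear assms(3,4) by blast
  have "M ** M' = mat 1" "M' ** M = mat 1"
    by (simp_all add: matrix_eq M M' assms(5,6) flip: matrix_vector_mul_assoc)
  then have "M \<in> O_L"
    using assms(7) M by (auto simp: O_L_def invertible_def)
  then show ?thesis using M that by blast
qed

lemma O_L_bil: "g \<in> O_L \<Longrightarrow> bil (g *v x) (g *v y) = bil x y"
  by (simp add: O_L_def)

lemma O_L_mult: "g \<in> O_L \<Longrightarrow> g' \<in> O_L \<Longrightarrow> g ** g' \<in> O_L"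
  by (auto simp: O_L_def invertible_mult simp flip: matrix_vector_mul_assoc)

lemma O_L_one: "mat 1 \<in> O_L"
  by (auto simp: O_L_def invertible_def intro!: exI [of _ "mat 1"])

lemma O_L_inverse:
  assumes "g \<in> O_L"
  obtains g' where "g' \<in> O_L" "g ** g' = mat 1" "g' ** g = mat 1"
proof -
  obtain g' where g': "g ** g' = mat 1" "g' ** g = mat 1"
    using assms by (auto simp: O_L_def invertible_def)
  have "bil (g' *v x) (g' *v y) = bil x y" for x y
    using O_L_bil [OF assms, of "g' *v x" "g' *v y"]
    by (simp add: matrix_vector_mul_assoc g')
  then have "g' \<in> O_L" using g' by (auto simp: O_L_def invertible_def)
  then show ?thesis using g' that by blast
qed

text \<open>
  The Eichler transvection with isotropic \<open>e\<close> and \<open>w\<close> orthogonal to \<open>e\<close>.  The parameter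
  \<open>q\<close> stands for half of \<open>bil w w\<close>, so that no division is needed over the integers.
\<close>

definition eichler :: "'a::comm_ring_1 ^ 7 \<Rightarrow> 'a ^ 7 \<Rightarrow> 'a \<Rightarrow> 'a ^ 7 \<Rightarrow> 'a ^ 7" where
  "eichler e w q v = v - bil w v *s e + bil e v *s w - (q * bil e v) *s e"

lemma eichler_in_O_L:
  assumes "bil e e = 0" "bil e w = 0" "bil w w = 2 * q"
  obtains g where "g \<in> O_L" "\<And>x. g *v x = eichler e w q x"
proof (rule O_L_of_linear [of "eichler e w q" "eichler e (- w) q"])
  have we: "bil w e = 0" using assms(2) by (simp add: bil_commute)
  show "bil (eichler e w q x) (eichler e w q y) = bil x y" for x y
    unfolding eichler_def using assms we
    by (simp add: bil_commute [of x e] bil_commute [of x w]) (simp add: algebra_simps)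
  show "eichler e (- w) q (eichler e w q x) = x" "eichler e w q (eichler e (- w) q x) = x" for x
    unfolding eichler_def using assms we
    by (simp_all add: vec_eq_iff algebra_simps)
qed (simp_all add: eichler_def vec_eq_iff algebra_simps)

lemma neg2_reflection_in_O_L:
  assumes "bil r r = - 2"
  obtains g where "g \<in> O_L" "\<And>x. g *v x = x + bil r x *s r"
  by (rule O_L_of_linear [of "\<lambda>x. x + bil r x *s r" "\<lambda>x. x + bil r x *s r"])
    (use assms in \<open>simp_all add: vec_eq_iff algebra_simps bil_commute\<close>)

lemma O_L_primitive:
  assumes "g \<in> O_L" "primitive x"
  shows "primitive (g *v x)"
proof -
  obtain g' where g': "g' ** g = mat 1" using O_L_inverse assms(1) by blast
  show ?thesis unfolding primitive_def
  proof (intro allI impI)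
    fix m y assume "g *v x = m *s y"
    then have "g' *v (g *v x) = m *s (g' *v y)" by (simp add: matrix_vector_mult_scale)
    then have "x = m *s (g' *v y)" by (simp add: matrix_vector_mul_assoc g')
    then show "is_unit m" using assms(2) unfolding primitive_def by blast
  qed
qed

section \<open>Primitive isotropic vectors\<close>

definition hyperbolic_pair :: "int ^ 7 \<Rightarrow> int ^ 7 \<Rightarrow> bool" where
  "hyperbolic_pair e f \<longleftrightarrow> bil e e = 0 \<and> bil f f = 0 \<and> bil e f = 1"

text \<open>
  On \<open>U + U\<close>, identified with the 2 by 2 matrices with form twice the determinant, the Eichler
  transvections are the elementary row and column operations, and this is the Smith normal form:
  both coordinates in the second plane vanish, and in the first plane one coordinate divides the
  other.  The proof is Euclid's algorithm, phrased as the choice of a vector in the orbit whose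
  coordinate \<open>bil f\<close> is nonzero of least absolute value.
\<close>

lemma two_hyperbolic_planes_normal_form:
  fixes e f e' f' v :: "int ^ 7"
  assumes hyp: "hyperbolic_pair e f" "hyperbolic_pair e' f'"
    and orth: "bil e e' = 0" "bil e f' = 0" "bil f e' = 0" "bil f f' = 0"
  obtains g where "g \<in> O_L"
    and "\<And>x. bil e x = 0 \<Longrightarrow> bil f x = 0 \<Longrightarrow> bil e' x = 0 \<Longrightarrow> bil f' x = 0 \<Longrightarrow> g *v x = x"
    and "bil e' (g *v v) = 0" "bil f' (g *v v) = 0" "bil f (g *v v) dvd bil e (g *v v)"
proof -
  define fixing where
    "fixing g \<longleftrightarrow> g \<in> O_L \<and>
      (\<forall>x. bil e x = 0 \<longrightarrow> bil f x = 0 \<longrightarrow> bil e' x = 0 \<longrightarrow> bil f' x = 0 \<longrightarrow> g *v x = x)" for g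
  define W where "W = {g *v v |g. fixing g}"
  have vals: "bil e e = 0" "bil f f = 0" "bil e f = 1" "bil f e = 1"
    "bil e' e' = 0" "bil f' f' = 0" "bil e' f' = 1" "bil f' e' = 1"
    "bil e e' = 0" "bil e' e = 0" "bil e f' = 0" "bil f' e = 0"
    "bil f e' = 0" "bil e' f = 0" "bil f f' = 0" "bil f' f = 0"
    using hyp orth by (auto simp: hyperbolic_pair_def bil_commute)
  have "v \<in> W"
    unfolding W_def fixing_def using O_L_one by (auto intro!: exI [of _ "mat 1"])
  have move: "eichler c (t *s w) 0 x \<in> W" if "x \<in> W" and cw: "c \<in> {e, f}" "w \<in> {e', f'}" for c w x t
  proof -
    obtain g where g: "fixing g" "x = g *v v" using \<open>x \<in> W\<close> by (auto simp: W_def)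
    obtain k where k: "k \<in> O_L" "\<And>x. k *v x = eichler c (t *s w) 0 x"
      by (rule eichler_in_O_L [of c "t *s w" 0]) (use cw vals in auto)
    have "fixing (k ** g)"
      using g k cw vals unfolding fixing_def
      by (auto simp: O_L_mult eichler_def simp flip: matrix_vector_mul_assoc)
    moreover have "eichler c (t *s w) 0 x = (k ** g) *v v"
      using g k by (simp flip: matrix_vector_mul_assoc)
    ultimately show ?thesis unfolding W_def by blast
  qed
  show ?thesis
  proof (cases "\<forall>x\<in>W. bil f x = 0")
    case True
    have zero: "bil w x = 0" if "x \<in> W" "w \<in> {e', f'}" for x w
    proof -
      have "bil f (eichler e (1 *s w) 0 x) = 0" using True move that by blast
      then show ?thesis using True that vals by (auto simp: eichler_def)
    qed
    have "bil f' (eichler e (1 *s e') 0 v) = 0" using zero move \<open>v \<in> W\<close> by blast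
    then have "bil e v = 0" using zero [OF \<open>v \<in> W\<close>] vals by (simp add: eichler_def)
    then show ?thesis
      using that [of "mat 1"] zero [OF \<open>v \<in> W\<close>] by (simp add: O_L_one)
  next
    case False
    then obtain x0 where "x0 \<in> W \<and> bil f x0 \<noteq> 0" by blast
    from ex_has_least_nat [of "\<lambda>x. x \<in> W \<and> bil f x \<noteq> 0", OF this, of "\<lambda>x. nat \<bar>bil f x\<bar>"]
    obtain x where x: "x \<in> W" "bil f x \<noteq> 0"
      and least: "\<And>y. y \<in> W \<Longrightarrow> bil f y \<noteq> 0 \<Longrightarrow> nat \<bar>bil f x\<bar> \<le> nat \<bar>bil f y\<bar>"
      by blast
    define a where "a = bil f x"
    have min: "\<not> \<bar>bil f y\<bar> < \<bar>a\<bar>" if "y \<in> W" "bil f y \<noteq> 0" for y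
      using least [OF that] by (simp add: a_def)
    \<comment> \<open>Otherwise the remainder could be produced as a coordinate and then be added to or subtracted
      from \<open>a\<close>, which would give a smaller nonzero value.\<close>
    have dvd: "a dvd bil w y"
      if y: "y \<in> W" "bil f y = a" and w: "(w, w') \<in> {(e', f'), (f', e')}" for w w' y
    proof (rule ccontr)
      assume not_dvd: "\<not> a dvd bil w y"
      define z where "z = eichler f ((- (bil w y div a)) *s w') 0 y"
      define r where "r = bil w y mod a"
      have zW: "z \<in> W"
        unfolding z_def by (rule move) (use y w in auto)
      have z: "bil f z = a"
        using y w vals by (auto simp: z_def eichler_def)
      have r: "bil w z = r"
        using w y vals minus_mult_div_eq_mod [of "bil w y" a]
        by (auto simp: z_def eichler_def r_def algebra_simps)
      have "r \<noteq> 0" using not_dvd by (simp add: r_def dvd_eq_mod_eq_0)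
      have "\<bar>r\<bar> < \<bar>a\<bar>" using x(2) by (simp add: r_def a_def abs_mod_less)
      define s :: int where "s = (if 0 < a \<longleftrightarrow> 0 < r then 1 else - 1)"
      have "bil f (eichler e (s *s w) 0 z) = a - s * r"
        using z r w vals by (auto simp: eichler_def)
      moreover have "0 < \<bar>a - s * r\<bar>" "\<bar>a - s * r\<bar> < \<bar>a\<bar>"
        using \<open>r \<noteq> 0\<close> \<open>\<bar>r\<bar> < \<bar>a\<bar>\<close> by (auto simp: s_def)
      ultimately show False
        using min [of "eichler e (s *s w) 0 z"] move [OF zW, of e w s] w by auto
    qed
    obtain m where m: "bil e' x = a * m"
      using dvd [OF x(1) a_def [symmetric], of e' f'] by blast
    define y where "y = eichler f ((- m) *s f') 0 x"
    have yW: "y \<in> W"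
      unfolding y_def by (rule move) (use x in auto)
    have y: "bil f y = a" "bil e' y = 0"
      using x vals m by (simp_all add: y_def eichler_def a_def)
    obtain n where n: "bil f' y = a * n"
      using dvd [OF yW y(1), of f' e'] by blast
    define z where "z = eichler f ((- n) *s e') 0 y"
    have zW: "z \<in> W"
      unfolding z_def by (rule move) (use yW in auto)
    have z: "bil f z = a" "bil e' z = 0" "bil f' z = 0"
      using y vals n by (simp_all add: z_def eichler_def)
    \<comment> \<open>This transvection copies the coordinate \<open>bil e\<close> of \<open>z\<close> to the coordinate \<open>bil f'\<close> and leaves
      \<open>bil f\<close> unchanged, so that \<open>dvd\<close> applies to it.\<close>
    have "eichler e (1 *s e') 0 z \<in> W"
      by (rule move) (use zW in auto)
    then have "a dvd bil f' (eichler e (1 *s e') 0 z)"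
      by (rule dvd [of _ f' e']) (use z vals in \<open>auto simp: eichler_def\<close>)
    then have "a dvd bil e z" using z vals by (simp add: eichler_def)
    then show ?thesis using that z zW by (auto simp: W_def fixing_def)
  qed
qed

text \<open>
  In Smith normal form the vector is \<open>(0, 0, d, d m, 0, 0, z)\<close>, and isotropy says
  \<open>d\<^sup>2 m = 3 z\<^sup>2\<close>.  Primitivity makes \<open>d\<close> and \<open>z\<close> coprime, so \<open>d\<^sup>2\<close> divides 3, whence
  \<open>d = 1\<close> or \<open>d = -1\<close>.  A transvection along the last coordinate then removes \<open>z\<close>, and with it the
  fourth coordinate.  It is here that the 6 in the form matters: the discriminant group of \<open>L\<close> has
  no nonzero isotropic element.
\<close>

lemma primitive_isotropic_to_unit_vec_3:
  assumes "primitive u" "bil u u = 0" "u $ 1 = 0" "u $ 2 = 0"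
  obtains g where "g \<in> O_L" "g *v unit_vec 1 = unit_vec 1"
    "g *v u = unit_vec 3 \<or> g *v u = - unit_vec 3"
proof -
  obtain g where g: "g \<in> O_L" and fix_g:
    "\<And>x. bil (unit_vec 3) x = 0 \<Longrightarrow> bil (unit_vec 4) x = 0 \<Longrightarrow> bil (unit_vec 5) x = 0 \<Longrightarrow>
      bil (unit_vec 6) x = 0 \<Longrightarrow> g *v x = x"
    and g0: "bil (unit_vec 5) (g *v u) = 0" "bil (unit_vec 6) (g *v u) = 0"
    and g_dvd: "bil (unit_vec 4) (g *v u) dvd bil (unit_vec 3) (g *v u)"
    by (rule two_hyperbolic_planes_normal_form [of "unit_vec 3" "unit_vec 4" "unit_vec 5" "unit_vec 6" u])
      (auto simp: hyperbolic_pair_def)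
  define w where "w = g *v u"
  have fix12: "g *v unit_vec 1 = unit_vec 1" "g *v unit_vec 2 = unit_vec 2"
    by (rule fix_g; simp)+
  have "bil (g *v unit_vec 1) w = 0" "bil (g *v unit_vec 2) w = 0"
    using assms unfolding w_def by (simp_all only: O_L_bil [OF g] bil_unit_vec)
  then have w12: "w $ 1 = 0" "w $ 2 = 0" by (simp_all add: fix12)
  have w56: "w $ 5 = 0" "w $ 6 = 0" and "w $ 3 dvd w $ 4"
    using g0 g_dvd by (simp_all add: w_def)
  then obtain m where m: "w $ 4 = w $ 3 * m" by blast
  have "bil w w = 0" using assms O_L_bil [OF g] by (simp add: w_def)
  then have iso: "w $ 3 * w $ 4 = 3 * (w $ 7)\<^sup>2"
    using w12 w56 by (simp add: bil_def power2_eq_square)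
  have "primitive w" using O_L_primitive [OF g assms(1)] by (simp add: w_def)
  have "coprime (w $ 3) (w $ 7)"
  proof (rule coprimeI)
    fix c assume "c dvd w $ 3" "c dvd w $ 7"
    then obtain k l where "w $ 3 = c * k" "w $ 7 = c * l" by blast
    then have "w = c *s (\<chi> i. if i = 3 then k else if i = 4 then k * m else if i = 7 then l else 0)"
      using w12 w56 m by (simp add: vec7_eq_iff)
    then show "is_unit c" using \<open>primitive w\<close> unfolding primitive_def by blast
  qed
  moreover have "(w $ 3)\<^sup>2 dvd 3 * (w $ 7)\<^sup>2"
    using iso m by (metis dvd_triv_left mult.assoc power2_eq_square)
  ultimately have "(w $ 3)\<^sup>2 dvd 3"
    by (simp add: coprime_dvd_mult_left_iff)
  then have "(w $ 3)\<^sup>2 \<le> 3" and "w $ 3 \<noteq> 0" by (auto dest: zdvd_imp_le)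
  have d: "w $ 3 = 1 \<or> w $ 3 = - 1"
  proof (rule ccontr)
    assume "\<not> ?thesis"
    with \<open>w $ 3 \<noteq> 0\<close> have "2 \<le> \<bar>w $ 3\<bar>" by arith
    then have "2\<^sup>2 \<le> \<bar>w $ 3\<bar>\<^sup>2" by (rule power_mono) simp
    then show False using \<open>(w $ 3)\<^sup>2 \<le> 3\<close> by simp
  qed
  \<comment> \<open>The transvection adds \<open>t d\<close> to the last coordinate \<open>z\<close>, and \<open>d\<close> is its own inverse.\<close>
  define t where "t = - (w $ 3 * w $ 7)"
  obtain k where k: "k \<in> O_L"
    "\<And>x. k *v x = eichler (unit_vec 4) (t *s unit_vec 7) (- 3 * t\<^sup>2) x"
    by (rule eichler_in_O_L [of "unit_vec 4" "t *s unit_vec 7" "- 3 * t\<^sup>2"])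
      (auto simp: power2_eq_square)
  have kw: "k *v w = w $ 3 *s unit_vec 3"
    using d w12 w56 iso
    by (auto simp: k vec7_eq_iff eichler_def t_def power2_eq_square)
  show ?thesis
  proof (rule that [of "k ** g"])
    show "k ** g \<in> O_L" by (simp add: O_L_mult g k)
    show "(k ** g) *v unit_vec 1 = unit_vec 1"
      by (simp add: k fix12 eichler_def vec_eq_iff flip: matrix_vector_mul_assoc)
    show "(k ** g) *v u = unit_vec 3 \<or> (k ** g) *v u = - unit_vec 3"
      using d kw by (auto simp: w_def vec_eq_iff simp flip: matrix_vector_mul_assoc)
  qed
qed

lemma primitive_isotropic_to_unit_vec_1:
  assumes "primitive u" "bil u u = 0"
  obtains g where "g \<in> O_L" "g *v u = unit_vec 1 \<or> g *v u = - unit_vec 1"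
proof -
  obtain g where g: "g \<in> O_L"
    and g0: "bil (unit_vec 1) (g *v u) = 0" "bil (unit_vec 2) (g *v u) = 0"
    by (rule two_hyperbolic_planes_normal_form [of "unit_vec 3" "unit_vec 4" "unit_vec 1" "unit_vec 2" u])
      (auto simp: hyperbolic_pair_def)
  obtain k where k: "k \<in> O_L" "k *v (g *v u) = unit_vec 3 \<or> k *v (g *v u) = - unit_vec 3"
    by (rule primitive_isotropic_to_unit_vec_3 [of "g *v u"])
      (use g g0 assms O_L_primitive O_L_bil in auto)
  obtain a where a: "a \<in> O_L" "\<And>x. a *v x = eichler (unit_vec 1) (unit_vec 4) 0 x"
    by (rule eichler_in_O_L [of "unit_vec 1" "unit_vec 4" 0]) auto
  obtain b where b: "b \<in> O_L" "\<And>x. b *v x = eichler (unit_vec 3) (- unit_vec 2) 0 x"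
    by (rule eichler_in_O_L [of "unit_vec 3" "- unit_vec 2" 0]) auto
  \<comment> \<open>The two transvections carry the third unit vector to \<open>e\<^sub>3 - e\<^sub>1\<close> and then to \<open>- e\<^sub>1\<close>.\<close>
  have "b *v (a *v unit_vec 3) = - unit_vec 1" "b *v (a *v - unit_vec 3) = unit_vec 1"
    by (simp_all add: a b eichler_def vec7_eq_iff)
  then have "(b ** a ** k ** g) *v u = unit_vec 1 \<or> (b ** a ** k ** g) *v u = - unit_vec 1"
    using k(2) by (auto simp flip: matrix_vector_mul_assoc)
  moreover have "b ** a ** k ** g \<in> O_L" by (simp add: O_L_mult g k a b)
  ultimately show ?thesis using that by blast
qed

section \<open>Rational isotropic planes\<close>

lemma ext_vec_nth [simp]: "ext_vec u $ i = of_int (u $ i)"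
  by (simp add: ext_vec_def)

lemma ext_vec_unit_vec [simp]: "ext_vec (unit_vec i) = unit_vec i"
  by (simp add: vec_eq_iff)

lemma ext_vec_uminus [simp]: "ext_vec (- u) = - ext_vec u"
  by (simp add: vec_eq_iff)

lemma bil_ext_vec: "bil (ext_vec u) (ext_vec v) = of_int (bil u v)"
  by (simp add: bil_def)

lemma ext_map_linear [simp]:
  "ext_map g (x + y) = ext_map g x + ext_map g y"
  "ext_map g (x - y) = ext_map g x - ext_map g y"
  "ext_map g (- x) = - ext_map g x"
  "ext_map g (c *s x) = c *s ext_map g x"
  "ext_map g 0 = 0"
  using matrix_vector_right_distrib [of "map_matrix of_int g" "x - y" y]
    matrix_vector_right_distrib [of "map_matrix of_int g" x "- x"]
  by (simp_all add: ext_map_def matrix_vector_right_distrib matrix_vector_mult_scale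
      add_eq_0_iff algebra_simps)

lemma ext_map_ext_vec: "ext_map g (ext_vec u) = ext_vec (g *v u)"
  by (simp add: ext_map_def vec_eq_iff matrix_vector_mult_def)

lemma ext_map_mult: "ext_map (g ** g') x = ext_map g (ext_map g' x)"
proof -
  have "map_matrix of_int (g ** g') = map_matrix of_int g ** (map_matrix of_int g' :: 'a ^ 7 ^ 7)"
    by (simp add: vec_eq_iff map_matrix_def matrix_matrix_mult_def)
  then show ?thesis by (simp add: ext_map_def matrix_vector_mul_assoc)
qed

lemma ext_map_one [simp]: "ext_map (mat 1) x = x"
proof -
  have "map_matrix of_int (mat 1) = (mat 1 :: 'a ^ 7 ^ 7)"
    by (simp add: vec_eq_iff map_matrix_def mat_def)
  then show ?thesis by (simp add: ext_map_def)
qed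

lemma ext_map_bil:
  assumes "g \<in> O_L"
  shows "bil (ext_map g x) (ext_map g y) = bil x (y :: 'a::comm_ring_1 ^ 7)"
proof -
  have sum: "ext_map g (\<Sum>i\<in>A. f i) = (\<Sum>i\<in>A. ext_map g (f i))" for f :: "7 \<Rightarrow> 'a ^ 7" and A
    by (induction A rule: infinite_finite_induct) simp_all
  have unit: "bil (ext_map g (unit_vec i)) (ext_map g (unit_vec j)) =
      bil (unit_vec i) (unit_vec j :: 'a ^ 7)" for i j
    using bil_ext_vec [of "g *v unit_vec i" "g *v unit_vec j", where 'a = 'a]
      bil_ext_vec [of "unit_vec i" "unit_vec j", where 'a = 'a]
    by (simp only: O_L_bil [OF assms] ext_vec_unit_vec flip: ext_map_ext_vec)
  have "bil (ext_map g (\<Sum>i\<in>UNIV. x $ i *s unit_vec i)) (ext_map g (\<Sum>j\<in>UNIV. y $ j *s unit_vec j))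
      = bil (\<Sum>i\<in>UNIV. x $ i *s unit_vec i) (\<Sum>j\<in>UNIV. y $ j *s unit_vec j)"
    by (simp only: sum bil_sum_left bil_sum_right ext_map_linear bil_linear unit)
  then show ?thesis by (simp add: basis_expansion)
qed

definition isotropic_plane :: "(rat ^ 7) set \<Rightarrow> bool" where
  "isotropic_plane E \<longleftrightarrow> vec.subspace E \<and> vec.dim E = 2 \<and> (\<forall>x\<in>E. \<forall>y\<in>E. bil x y = 0)"

lemma isotropic_plane_ext_map:
  assumes "g \<in> O_L" "isotropic_plane E"
  shows "isotropic_plane (ext_map g ` E)"
proof -
  obtain g' where g': "g' ** g = mat 1" using O_L_inverse assms(1) by blast
  have "inj (ext_map g :: rat ^ 7 \<Rightarrow> _)"
    by (rule inj_on_inverseI [of _ "ext_map g'"]) (simp add: g' flip: ext_map_mult)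
  then have "vec.dim (ext_map g ` E) = vec.dim E"
    unfolding ext_map_def
    by (intro vec.dim_image_eq matrix_vector_mul_linear_gen) (auto intro: inj_on_subset)
  moreover have "vec.subspace (ext_map g ` E)"
    using assms(2) unfolding ext_map_def isotropic_plane_def by (auto intro: vec.subspace_image)
  ultimately show ?thesis
    using assms by (auto simp: isotropic_plane_def ext_map_bil)
qed

lemma primitive_multiple:
  fixes x :: "rat ^ 7"
  assumes "x \<noteq> 0"
  obtains c u where "c \<noteq> 0" "x = c *s ext_vec u" "primitive u"
proof -
  define N where "N = (\<Prod>i\<in>UNIV. snd (quotient_of (x $ i)))"
  have den: "snd (quotient_of r) > 0" for r by (simp add: quotient_of_denom_pos')
  have "N > 0" unfolding N_def using den by (intro prod_pos) auto
  have "\<exists>a. of_int N * x $ i = of_int a" for i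
  proof -
    have "snd (quotient_of (x $ i)) dvd N" unfolding N_def by (intro dvd_prodI) auto
    then obtain k where k: "N = snd (quotient_of (x $ i)) * k" by blast
    have "x $ i = of_int (fst (quotient_of (x $ i))) / of_int (snd (quotient_of (x $ i)))"
      by (intro quotient_of_div) simp
    then have "of_int (snd (quotient_of (x $ i))) * x $ i = of_int (fst (quotient_of (x $ i)))"
      using den [of "x $ i"] by (metis less_irrefl nonzero_mult_div_cancel_left of_int_eq_0_iff
          times_divide_eq_right)
    then have "of_int N * x $ i = of_int (fst (quotient_of (x $ i)) * k)"
      by (simp add: k mult.commute mult.left_commute)
    then show ?thesis by blast
  qed
  then obtain a where a: "\<And>i. of_int N * x $ i = of_int (a i)" by metis
  define d where "d = Gcd (range a)"
  have "d dvd a i" for i unfolding d_def by (intro Gcd_dvd) simp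
  then have "a i = d * (a i div d)" for i by simp
  then obtain b where b: "\<And>i. a i = d * b i" by (rule that)
  have "d \<noteq> 0"
  proof
    assume "d = 0"
    then have "of_int N * x $ i = 0" for i using a b by simp
    then show False using \<open>N > 0\<close> assms by (auto simp: vec_eq_iff)
  qed
  show ?thesis
  proof
    show "of_int d / of_int N \<noteq> (0::rat)" using \<open>d \<noteq> 0\<close> \<open>N > 0\<close> by simp
    show "x = (of_int d / of_int N) *s ext_vec (\<chi> i. b i)"
      using \<open>N > 0\<close> a b by (simp add: vec_eq_iff field_simps)
    show "primitive (\<chi> i. b i)" unfolding primitive_def
    proof (intro allI impI)
      fix m y assume eq: "(\<chi> i. b i) = m *s y"
      have "b i = m * y $ i" for i using arg_cong [OF eq, of "\<lambda>v. v $ i"] by simp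
      then have "d * m dvd a i" for i by (simp add: b)
      then have "d * m dvd Gcd (range a)" by (intro Gcd_greatest) auto
      then have "d * m dvd d" by (simp only: d_def)
      then show "is_unit m" using \<open>d \<noteq> 0\<close> by simp
    qed
  qed
qed

text \<open>
  Two successive choices of a primitive integral vector in the plane are moved to \<open>\<plusminus> e\<^sub>1\<close> and
  \<open>\<plusminus> e\<^sub>3\<close>; the sign is irrelevant for the span.  The second vector can be taken in the orthogonal
  complement of the first hyperbolic plane, because it is orthogonal to \<open>e\<^sub>1\<close> and may be changed by
  multiples of \<open>e\<^sub>1\<close>.
\<close>

lemma isotropic_plane_transitive:
  assumes "isotropic_plane E"
  obtains g where "g \<in> O_L" "ext_map g ` E = vec.span {unit_vec 1, unit_vec 3}"
proof -
  have outside: "\<exists>x\<in>E. x \<notin> vec.span A" if "isotropic_plane E" "finite A" "card A < 2" for E A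
  proof (rule ccontr)
    assume "\<not> ?thesis"
    then have "vec.dim E \<le> card A" using that by (intro vec.dim_le_card) auto
    then show False using that by (simp add: isotropic_plane_def)
  qed
  have scale_mem: "ext_vec u \<in> E" if "c *s ext_vec u \<in> E" "c \<noteq> 0" "isotropic_plane E" for c u E
    using that vec.subspace_scale [of E "c *s ext_vec u" "1 / c"]
    by (simp add: isotropic_plane_def)
  obtain x where "x \<in> E" "x \<noteq> 0" using outside [OF assms, of "{}"] by auto
  obtain c u where u: "c \<noteq> 0" "x = c *s ext_vec u" "primitive u"
    using primitive_multiple [OF \<open>x \<noteq> 0\<close>] .
  have "ext_vec u \<in> E" using scale_mem u \<open>x \<in> E\<close> assms by blast
  then have "bil u u = 0"
    using assms bil_ext_vec [of u u, where 'a = rat] by (simp add: isotropic_plane_def)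
  then obtain g where g: "g \<in> O_L" "g *v u = unit_vec 1 \<or> g *v u = - unit_vec 1"
    using primitive_isotropic_to_unit_vec_1 \<open>primitive u\<close> by blast
  define F where "F = ext_map g ` E"
  have F: "isotropic_plane F" using isotropic_plane_ext_map g assms by (simp add: F_def)
  then have sub: "vec.subspace F" by (simp add: isotropic_plane_def)
  have "ext_vec (g *v u) \<in> F"
    using \<open>ext_vec u \<in> E\<close> by (auto simp: F_def simp flip: ext_map_ext_vec)
  then have e1: "unit_vec 1 \<in> F"
    using g(2) vec.subspace_neg [OF sub] by fastforce
  obtain y where y: "y \<in> F" "y \<notin> vec.span {unit_vec 1}"
    using outside [OF F, of "{unit_vec 1}"] by auto
  define z where "z = y - y $ 1 *s unit_vec 1"
  have "z \<in> F"
    unfolding z_def using y e1 sub by (intro vec.subspace_diff vec.subspace_scale)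
  have "z \<noteq> 0"
  proof
    assume "z = 0"
    then have "y = y $ 1 *s unit_vec 1" by (simp add: z_def)
    then show False using y(2) by (metis insertI1 vec.span_base vec.span_scale)
  qed
  obtain c' w where w: "c' \<noteq> 0" "z = c' *s ext_vec w" "primitive w"
    using primitive_multiple [OF \<open>z \<noteq> 0\<close>] .
  have "ext_vec w \<in> F" using scale_mem w \<open>z \<in> F\<close> F by blast
  then have "bil w w = 0"
    using F bil_ext_vec [of w w, where 'a = rat] by (simp add: isotropic_plane_def)
  have "z $ 1 = 0" by (simp add: z_def)
  then have "w $ 1 = 0" using w by simp
  have "bil (unit_vec 1) (ext_vec w :: rat ^ 7) = 0"
    using F e1 \<open>ext_vec w \<in> F\<close> by (simp only: isotropic_plane_def)
  then have "w $ 2 = 0" by simp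
  obtain k where k: "k \<in> O_L" "k *v unit_vec 1 = unit_vec 1"
    "k *v w = unit_vec 3 \<or> k *v w = - unit_vec 3"
    using primitive_isotropic_to_unit_vec_3
      [OF \<open>primitive w\<close> \<open>bil w w = 0\<close> \<open>w $ 1 = 0\<close> \<open>w $ 2 = 0\<close>] .
  define D where "D = ext_map k ` F"
  have D: "isotropic_plane D" using isotropic_plane_ext_map k F by (simp add: D_def)
  then have subD: "vec.subspace D" and dimD: "vec.dim D = 2" by (simp_all add: isotropic_plane_def)
  have "ext_vec (k *v w) \<in> D"
    using \<open>ext_vec w \<in> F\<close> by (auto simp: D_def simp flip: ext_map_ext_vec)
  then have e3: "unit_vec 3 \<in> D"
    using k(3) vec.subspace_neg [OF subD] by fastforce
  have "ext_map k (unit_vec 1) = (unit_vec 1 :: rat ^ 7)"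
    by (metis ext_map_ext_vec ext_vec_unit_vec k(2))
  then have e1': "unit_vec 1 \<in> D"
    using e1 by (metis D_def imageI)
  have ind: "vec.independent {unit_vec 1, unit_vec 3 :: rat ^ 7}"
    by (rule vec.independent_insertI)
      (auto simp: vec.span_singleton vec_eq_iff forall_7)
  have card: "card {unit_vec 1, unit_vec 3 :: rat ^ 7} = 2"
    by (simp add: axis_eq_axis)
  have "D \<subseteq> vec.span {unit_vec 1, unit_vec 3}"
    by (rule vec.card_ge_dim_independent) (use e1' e3 ind card dimD in auto)
  moreover have "vec.span {unit_vec 1, unit_vec 3} \<subseteq> D"
    using e1' e3 subD by (intro vec.span_minimal) auto
  ultimately have "D = vec.span {unit_vec 1, unit_vec 3}" by blast
  moreover have "D = ext_map (k ** g) ` E"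
    by (simp add: D_def F_def image_image ext_map_mult)
  ultimately show ?thesis using that O_L_mult g k by blast
qed

section \<open>Vectors orthogonal to the standard isotropic plane\<close>

definition plane_fixers :: "(int ^ 7 ^ 7) set" where
  "plane_fixers = {g \<in> O_L. g *v unit_vec 1 = unit_vec 1 \<and> g *v unit_vec 3 = unit_vec 3}"

lemma plane_fixers_mult: "g \<in> plane_fixers \<Longrightarrow> k \<in> plane_fixers \<Longrightarrow> g ** k \<in> plane_fixers"
  by (auto simp: plane_fixers_def O_L_mult simp flip: matrix_vector_mul_assoc)

lemma plane_fixers_nth:
  assumes "g \<in> plane_fixers"
  shows "(g *v w) $ 2 = w $ 2" "(g *v w) $ 4 = w $ 4"
proof -
  have g: "g \<in> O_L" "g *v unit_vec 1 = unit_vec 1" "g *v unit_vec 3 = unit_vec 3"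
    using assms by (simp_all add: plane_fixers_def)
  show "(g *v w) $ 2 = w $ 2" "(g *v w) $ 4 = w $ 4"
    using O_L_bil [OF g(1), of "unit_vec 1" w] O_L_bil [OF g(1), of "unit_vec 3" w]
    by (simp_all only: g bil_unit_vec)
qed

lemma exists_small_residue:
  fixes x z :: int
  assumes "x \<noteq> 0"
  obtains t where "2 * \<bar>z + t * x\<bar> \<le> \<bar>x\<bar>"
proof -
  define r where "r = z mod \<bar>x\<bar>"
  have r: "0 \<le> r" "r < \<bar>x\<bar>" using assms by (simp_all add: r_def)
  have z: "z = \<bar>x\<bar> * (z div \<bar>x\<bar>) + r" by (simp add: r_def)
  have "\<exists>q. 2 * \<bar>z + q * \<bar>x\<bar>\<bar> \<le> \<bar>x\<bar>"
  proof (cases "2 * r \<le> \<bar>x\<bar>")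
    case True
    have "z + (- (z div \<bar>x\<bar>)) * \<bar>x\<bar> = r" using z by (simp add: algebra_simps)
    then show ?thesis using True r by (metis abs_of_nonneg)
  next
    case False
    have "z + (- (z div \<bar>x\<bar>) - 1) * \<bar>x\<bar> = r - \<bar>x\<bar>" using z by (simp add: algebra_simps)
    moreover have "2 * \<bar>r - \<bar>x\<bar>\<bar> \<le> \<bar>x\<bar>" using False r by arith
    ultimately show ?thesis by metis
  qed
  then obtain q where "2 * \<bar>z + q * \<bar>x\<bar>\<bar> \<le> \<bar>x\<bar>" by blast
  moreover have "q * \<bar>x\<bar> = (q * sgn x) * x" by (simp add: mult.assoc mult_sgn_abs abs_sgn mult.commute [of x])
  ultimately show ?thesis using that by metis
qed

lemma exists_mod_residue:
  fixes x a :: int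
  assumes "x \<noteq> 0"
  obtains t where "0 \<le> a - t * x" "a - t * x < \<bar>x\<bar>"
proof -
  have "(a div \<bar>x\<bar> * sgn x) * x = a div \<bar>x\<bar> * \<bar>x\<bar>"
    by (simp add: mult.assoc abs_sgn mult.commute [of x])
  then have "a - (a div \<bar>x\<bar> * sgn x) * x = a mod \<bar>x\<bar>"
    by (simp only: minus_div_mult_eq_mod)
  then show ?thesis using that [of "a div \<bar>x\<bar> * sgn x"] assms by simp
qed

text \<open>
  The last three coordinates \<open>(x, y, z)\<close> behave like a binary quadratic form, and the proof is
  Gauss reduction: a transvection changes \<open>z\<close> by a multiple of \<open>x\<close>, and the reflection in
  \<open>e\<^sub>5 - e\<^sub>6\<close> exchanges \<open>x\<close> and \<open>y\<close> when this makes \<open>\<bar>x\<bar>\<close> smaller.  Positivity of the norm keeps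
  \<open>x\<close> away from 0.
\<close>

lemma reduce_hyperbolic_coordinates:
  assumes "w $ 2 = 0" "w $ 4 = 0" "bil w w > 0"
  shows "\<exists>g\<in>plane_fixers. \<bar>(g *v w) $ 5\<bar> \<le> \<bar>(g *v w) $ 6\<bar> \<and> 2 * \<bar>(g *v w) $ 7\<bar> \<le> \<bar>(g *v w) $ 5\<bar>"
  using assms
proof (induction "nat \<bar>w $ 5\<bar>" arbitrary: w rule: less_induct)
  case less
  have "2 * (w $ 5 * w $ 6) - 6 * (w $ 7)\<^sup>2 > 0"
    using less.prems by (simp add: bil_def power2_eq_square)
  then have "w $ 5 \<noteq> 0" by (auto simp: not_less)
  then obtain t where t: "2 * \<bar>w $ 7 + t * w $ 5\<bar> \<le> \<bar>w $ 5\<bar>"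
    by (rule exists_small_residue)
  obtain g where g: "g \<in> O_L"
    "\<And>x. g *v x = eichler (unit_vec 6) (t *s unit_vec 7) (- 3 * t\<^sup>2) x"
    by (rule eichler_in_O_L [of "unit_vec 6" "t *s unit_vec 7" "- 3 * t\<^sup>2"])
      (auto simp: power2_eq_square)
  have g_fix: "g \<in> plane_fixers"
    using g by (auto simp: plane_fixers_def eichler_def vec7_eq_iff)
  define v where "v = g *v w"
  have v: "v $ 5 = w $ 5" "2 * \<bar>v $ 7\<bar> \<le> \<bar>v $ 5\<bar>" "v $ 2 = 0" "v $ 4 = 0"
    using t less.prems by (auto simp: v_def g eichler_def mult.commute)
  have v_pos: "bil v v > 0" using O_L_bil [OF g(1)] less.prems by (simp add: v_def)
  show ?case
  proof (cases "\<bar>v $ 5\<bar> \<le> \<bar>v $ 6\<bar>")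
    case True
    then show ?thesis using v(2) g_fix unfolding v_def by blast
  next
    case False
    obtain s where s: "s \<in> O_L"
      "\<And>x. s *v x = x + bil (unit_vec 5 - unit_vec 6) x *s (unit_vec 5 - unit_vec 6)"
      by (rule neg2_reflection_in_O_L [of "unit_vec 5 - unit_vec 6"]) auto
    have s_fix: "s \<in> plane_fixers"
      using s by (auto simp: plane_fixers_def vec7_eq_iff)
    define u where "u = s *v v"
    have u: "u $ 5 = v $ 6" "u $ 2 = 0" "u $ 4 = 0"
      using v by (auto simp: u_def s)
    have "bil u u > 0" using O_L_bil [OF s(1)] v_pos by (simp add: u_def)
    moreover have "nat \<bar>u $ 5\<bar> < nat \<bar>w $ 5\<bar>" using False u v by simp
    ultimately obtain k where k: "k \<in> plane_fixers" "\<bar>(k *v u) $ 5\<bar> \<le> \<bar>(k *v u) $ 6\<bar>"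
      "2 * \<bar>(k *v u) $ 7\<bar> \<le> \<bar>(k *v u) $ 5\<bar>"
      using less.hyps u by blast
    then show ?thesis
      using g_fix s_fix
      by (intro bexI [of _ "k ** s ** g"])
        (auto simp: plane_fixers_mult u_def v_def simp flip: matrix_vector_mul_assoc)
  qed
qed

text \<open>
  On vectors orthogonal to \<open>e\<^sub>1\<close> and \<open>e\<^sub>3\<close> the transvections along these vectors, with second
  argument a multiple of \<open>e\<^sub>6\<close>, change only the coordinates 1 and 3, by multiples of
  coordinate 5.
\<close>

lemma reduce_plane_coordinates:
  assumes "w $ 2 = 0" "w $ 4 = 0" "w $ 5 \<noteq> 0"
  shows "\<exists>g\<in>plane_fixers. (g *v w) $ 1 \<in> {0..<\<bar>w $ 5\<bar>} \<and> (g *v w) $ 3 \<in> {0..<\<bar>w $ 5\<bar>} \<and>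
    (g *v w) $ 5 = w $ 5 \<and> (g *v w) $ 6 = w $ 6 \<and> (g *v w) $ 7 = w $ 7"
proof -
  obtain t where t: "0 \<le> w $ 1 - t * w $ 5" "w $ 1 - t * w $ 5 < \<bar>w $ 5\<bar>"
    using exists_mod_residue assms(3) by blast
  obtain s where s: "0 \<le> w $ 3 - s * w $ 5" "w $ 3 - s * w $ 5 < \<bar>w $ 5\<bar>"
    using exists_mod_residue assms(3) by blast
  obtain g where g: "g \<in> O_L" "\<And>x. g *v x = eichler (unit_vec 1) (t *s unit_vec 6) 0 x"
    by (rule eichler_in_O_L [of "unit_vec 1" "t *s unit_vec 6" 0]) auto
  obtain k where k: "k \<in> O_L" "\<And>x. k *v x = eichler (unit_vec 3) (s *s unit_vec 6) 0 x"
    by (rule eichler_in_O_L [of "unit_vec 3" "s *s unit_vec 6" 0]) auto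
  have "g \<in> plane_fixers" "k \<in> plane_fixers"
    using g k by (auto simp: plane_fixers_def eichler_def vec7_eq_iff)
  then have "k ** g \<in> plane_fixers" by (rule plane_fixers_mult [rotated])
  then show ?thesis
    using assms s t
    by (intro bexI [of _ "k ** g"])
      (auto simp: g k eichler_def simp flip: matrix_vector_mul_assoc)
qed

text \<open>
  A box of integral parameters that contains all reduced vectors \<open>(a, 0, b, 0, x, y, z)\<close> of norm
  \<open>2 p\<^sup>2\<close>: as \<open>x y = p\<^sup>2 + 3 z\<^sup>2\<close>, the coordinate \<open>y\<close> is determined by the others.
\<close>

definition normal_forms :: "int \<Rightarrow> (int ^ 7) set" where
  "normal_forms p =
    (\<lambda>((x, z), a, b). \<chi> i. if i = 1 then a else if i = 3 then b else if i = 5 then x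
        else if i = 6 then (p\<^sup>2 + 3 * z\<^sup>2) div x else if i = 7 then z else 0)
    ` (({- (2 * p)..2 * p} \<times> {- p..p}) \<times> ({0..<2 * p} \<times> {0..<2 * p}))"

text \<open>
  The usual bound for reduced forms: from \<open>x\<^sup>2 \<le> \<bar>x y\<bar> = p\<^sup>2 + 3 z\<^sup>2\<close> and \<open>4 z\<^sup>2 \<le> x\<^sup>2\<close> follows
  \<open>x\<^sup>2 \<le> 4 p\<^sup>2\<close>, which bounds all the coordinates.
\<close>

lemma normal_formsI:
  assumes "p > 0" and w: "w $ 2 = 0" "w $ 4 = 0" "bil w w = 2 * p\<^sup>2"
    and "\<bar>w $ 5\<bar> \<le> \<bar>w $ 6\<bar>" "2 * \<bar>w $ 7\<bar> \<le> \<bar>w $ 5\<bar>" "w $ 1 \<in> {0..<\<bar>w $ 5\<bar>}" "w $ 3 \<in> {0..<\<bar>w $ 5\<bar>}"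
  shows "w \<in> normal_forms p"
proof -
  have eq: "w $ 5 * w $ 6 = p\<^sup>2 + 3 * (w $ 7)\<^sup>2"
    using w by (simp add: bil_def power2_eq_square mult.commute)
  have "(w $ 5)\<^sup>2 \<le> \<bar>w $ 5\<bar> * \<bar>w $ 6\<bar>"
    using assms(5) by (metis abs_ge_zero mult_left_mono power2_abs power2_eq_square)
  also have "\<dots> = p\<^sup>2 + 3 * (w $ 7)\<^sup>2"
    using eq by (simp flip: abs_mult)
  finally have "4 * (w $ 5)\<^sup>2 \<le> 4 * p\<^sup>2 + 3 * (2 * w $ 7)\<^sup>2" by (simp add: power_mult_distrib)
  moreover have "(2 * w $ 7)\<^sup>2 \<le> (w $ 5)\<^sup>2"
    using assms(6) by (intro abs_le_square_iff [THEN iffD1]) (simp add: abs_mult)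
  ultimately have "(w $ 5)\<^sup>2 \<le> (2 * p)\<^sup>2" by (simp add: power_mult_distrib)
  then have w5: "\<bar>w $ 5\<bar> \<le> 2 * p"
    using \<open>p > 0\<close> abs_le_square_iff [of "w $ 5" "2 * p"] by simp
  have "w $ 5 \<noteq> 0" using assms(7) by auto
  then have "w $ 6 = (p\<^sup>2 + 3 * (w $ 7)\<^sup>2) div w $ 5"
    by (simp flip: eq)
  then show ?thesis
    unfolding normal_forms_def using w5 assms
    by (intro image_eqI [of _ _ "((w $ 5, w $ 7), w $ 1, w $ 3)"]) (auto simp: vec7_eq_iff)
qed

lemma card_normal_forms:
  assumes "n > 0"
  shows "finite (normal_forms (int n))" "card (normal_forms (int n)) \<le> 60 * n ^ 4"
proof -
  show "finite (normal_forms (int n))" by (simp add: normal_forms_def)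
  have "card (normal_forms (int n)) \<le>
      card (({- (2 * int n)..2 * int n} \<times> {- int n..int n}) \<times> ({0..<2 * int n} \<times> {0..<2 * int n}))"
    unfolding normal_forms_def by (rule card_image_le) simp
  also have "\<dots> = ((4 * n + 1) * (2 * n + 1)) * ((2 * n) * (2 * n))"
    by (simp add: card_cartesian_product nat_add_distrib nat_mult_distrib)
  also have "\<dots> \<le> ((5 * n) * (3 * n)) * ((2 * n) * (2 * n))"
    using assms by (intro mult_le_mono) auto
  finally show "card (normal_forms (int n)) \<le> 60 * n ^ 4"
    by (simp add: power4_eq_xxxx mult.assoc)
qed

text \<open>
  The orthogonal complement of \<open>h\<close> contains the plane, so the image of \<open>h\<close> is orthogonal to the
  standard plane and is reduced by isometries that fix this plane pointwise.
\<close>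

lemma isotropic_plane_normal_form:
  assumes "isotropic_plane E" "E \<subseteq> perp h" "bil h h = 2 * p\<^sup>2" "p > 0"
  obtains g where "g \<in> O_L" "ext_map g ` E = vec.span {unit_vec 1, unit_vec 3}"
    "g *v h \<in> normal_forms p"
proof -
  obtain g where g: "g \<in> O_L" and gE: "ext_map g ` E = vec.span {unit_vec 1, unit_vec 3}"
    using isotropic_plane_transitive assms(1) by blast
  define w where "w = g *v h"
  have "bil (ext_vec w) x = 0" if "x \<in> vec.span {unit_vec 1, unit_vec 3}" for x :: "rat ^ 7"
  proof -
    obtain y where "y \<in> E" "x = ext_map g y" using \<open>x \<in> _\<close> gE by blast
    then show ?thesis
      using assms(2) ext_map_bil [OF g, of "ext_vec h" y]
      by (auto simp: w_def perp_def ext_map_ext_vec)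
  qed
  from this [of "unit_vec 1"] this [of "unit_vec 3"] have w: "w $ 2 = 0" "w $ 4 = 0"
    by (simp_all add: vec.span_base)
  have ww: "bil w w = 2 * p\<^sup>2" using O_L_bil [OF g] assms(3) by (simp add: w_def)
  then have "bil w w > 0" using \<open>p > 0\<close> by simp
  then obtain k where k: "k \<in> plane_fixers" "\<bar>(k *v w) $ 5\<bar> \<le> \<bar>(k *v w) $ 6\<bar>"
    "2 * \<bar>(k *v w) $ 7\<bar> \<le> \<bar>(k *v w) $ 5\<bar>"
    using reduce_hyperbolic_coordinates w by blast
  define v where "v = k *v w"
  have v: "v $ 2 = 0" "v $ 4 = 0" using plane_fixers_nth k w by (simp_all add: v_def)
  have kO: "k \<in> O_L" using k by (simp add: plane_fixers_def)
  have vv: "bil v v = 2 * p\<^sup>2" using O_L_bil [OF kO] ww by (simp add: v_def)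
  have "v $ 5 \<noteq> 0"
  proof
    assume "v $ 5 = 0"
    then have "2 * p\<^sup>2 = - 6 * (v $ 7)\<^sup>2" using vv v by (simp add: bil_def power2_eq_square)
    moreover have "p\<^sup>2 > 0" using \<open>p > 0\<close> by simp
    ultimately show False using zero_le_power2 [of "v $ 7"] by linarith
  qed
  then obtain l where l: "l \<in> plane_fixers" "(l *v v) $ 1 \<in> {0..<\<bar>v $ 5\<bar>}"
    "(l *v v) $ 3 \<in> {0..<\<bar>v $ 5\<bar>}" "(l *v v) $ 5 = v $ 5" "(l *v v) $ 6 = v $ 6" "(l *v v) $ 7 = v $ 7"
    using reduce_plane_coordinates v by blast
  have lO: "l \<in> O_L" using l by (simp add: plane_fixers_def)
  have "l *v v \<in> normal_forms p"
    using \<open>p > 0\<close> k l v vv plane_fixers_nth [OF l(1)] O_L_bil [OF lO]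
    by (intro normal_formsI) (simp_all add: v_def)
  define m where "m = l ** k"
  have m: "m \<in> plane_fixers" using l k by (simp add: m_def plane_fixers_mult)
  have "vec.span {unit_vec 1, unit_vec 3} \<subseteq> {x :: rat ^ 7. ext_map m x = x}"
  proof (rule vec.span_minimal)
    have "ext_map m (ext_vec (unit_vec i)) = (ext_vec (unit_vec i) :: rat ^ 7)" if "i = 1 \<or> i = 3" for i
      using m that unfolding ext_map_ext_vec by (auto simp: plane_fixers_def)
    then show "{unit_vec 1, unit_vec 3} \<subseteq> {x :: rat ^ 7. ext_map m x = x}" by simp
    show "vec.subspace {x :: rat ^ 7. ext_map m x = x}" by (simp add: vec.subspace_def)
  qed
  then have "ext_map m ` vec.span {unit_vec 1, unit_vec 3} = (vec.span {unit_vec 1, unit_vec 3} :: (rat ^ 7) set)"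
    by (force simp: image_iff)
  then have "ext_map (m ** g) ` E = vec.span {unit_vec 1, unit_vec 3}"
    by (simp add: ext_map_mult flip: image_image gE)
  moreover have "(m ** g) *v h \<in> normal_forms p"
    using \<open>l *v v \<in> _\<close> by (simp add: m_def v_def w_def flip: matrix_vector_mul_assoc)
  moreover have "m ** g \<in> O_L" using m g by (simp add: plane_fixers_def O_L_mult)
  ultimately show ?thesis using that by blast
qed

section \<open>The real spinor norm\<close>

lemma reflection_isometry:
  assumes "bil v v \<noteq> 0"
  shows "bil (reflection v x) (reflection v y) = bil x y"
  using assms by (simp add: reflection_def bil_commute [of v x] bil_commute [of v y] field_simps)

lemma reflection_involution:
  assumes "bil v v \<noteq> 0"
  shows "reflection v (reflection v x) = x"
  using assms by (simp add: reflection_def vec_eq_iff field_simps)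

lemma reflection_swap:
  assumes "bil x x = bil y y" "bil (x - y) (x - y) \<noteq> 0"
  shows "reflection (x - y) x = y"
proof -
  have "2 * bil x (x - y) = bil (x - y) (x - y)"
    using assms(1) by (simp add: bil_commute)
  then show ?thesis using assms(2) by (simp add: reflection_def)
qed

lemma reflection_fixes: "bil x v = 0 \<Longrightarrow> reflection v x = x"
  by (simp add: reflection_def)

lemma reflections_isometry:
  assumes "\<forall>v\<in>set vs. bil v v \<noteq> 0"
  shows "bil (foldr reflection vs x) (foldr reflection vs y) = bil x y"
  using assms by (induction vs) (simp_all add: reflection_isometry)

lemma reflections_rev:
  assumes "\<forall>v\<in>set vs. bil v v \<noteq> 0"
  shows "foldr reflection (rev vs) (foldr reflection vs x) = x"
  using assms by (induction vs) (simp_all add: reflection_involution)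

lemma reflections_fix:
  assumes "\<forall>v\<in>set vs. bil v x = 0"
  shows "foldr reflection vs x = x"
  using assms by (induction vs) (simp_all add: reflection_fixes bil_commute)

text \<open>
  The step of the Cartan--Dieudonne theorem.  The norms of \<open>g b - b\<close> and \<open>g b + b\<close> add up to four
  times that of \<open>b\<close>, so one of these vectors is not isotropic, and the reflection in it maps \<open>g b\<close>
  to \<open>b\<close> or \<open>- b\<close>.  All vectors used are orthogonal to \<open>A\<close>, so that what was already fixed remains
  fixed.
\<close>

lemma reflections_restore_vector:
  assumes iso: "\<And>x y. bil (g x) (g y) = bil x y" and fixes_A: "\<forall>a\<in>A. g a = a"
    and b: "bil b b \<noteq> 0" "\<forall>a\<in>A. bil b a = 0"
  obtains vs where "\<forall>v\<in>set vs. bil v v \<noteq> 0 \<and> (\<forall>a\<in>A. bil v a = 0)"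
    "foldr reflection vs (g b) = b"
proof -
  have gb: "\<forall>a\<in>A. bil (g b) a = 0" using iso [of b] fixes_A b(2) by metis
  show ?thesis
  proof (cases "bil (g b - b) (g b - b) = 0")
    case False
    then have "reflection (g b - b) (g b) = b" using iso by (intro reflection_swap)
    then show ?thesis using that [of "[g b - b]"] False gb b(2) by simp
  next
    case True
    have "bil (g b - b) (g b - b) + bil (g b - (- b)) (g b - (- b)) = 4 * bil b b"
      using iso [of b b] by simp
    then have nz: "bil (g b - (- b)) (g b - (- b)) \<noteq> 0" using True b(1) by simp
    then have "reflection (g b - (- b)) (g b) = - b"
      using iso by (intro reflection_swap) simp_all
    moreover have "reflection b (- b) = b" using b(1) by (simp add: reflection_def vec_eq_iff)
    ultimately have "foldr reflection [b, g b - (- b)] (g b) = b" by simp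
    moreover have "\<forall>v\<in>set [b, g b - (- b)]. bil v v \<noteq> 0 \<and> (\<forall>a\<in>A. bil v a = 0)"
      using nz gb b by simp
    ultimately show ?thesis using that by blast
  qed
qed

lemma reflections_restore_orthogonal_list:
  assumes "\<And>x y. bil (g x) (g y) = bil x y" "\<forall>a\<in>A. g a = a"
    and "\<forall>b\<in>set bs. bil b b \<noteq> 0 \<and> (\<forall>a\<in>A. bil b a = 0)"
    and "sorted_wrt (\<lambda>b c. bil b c = 0) bs"
  shows "\<exists>vs. (\<forall>v\<in>set vs. bil v v \<noteq> 0 \<and> (\<forall>a\<in>A. bil v a = 0)) \<and>
    (\<forall>a\<in>A \<union> set bs. foldr reflection vs (g a) = a)"
  using assms
proof (induction bs arbitrary: g A)
  case Nil
  then show ?case by (auto intro!: exI [of _ "[]"])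
next
  case (Cons b bs)
  obtain vs where vs: "\<forall>v\<in>set vs. bil v v \<noteq> 0 \<and> (\<forall>a\<in>A. bil v a = 0)"
    "foldr reflection vs (g b) = b"
    by (rule reflections_restore_vector [of g A b]) (use Cons.prems in auto)
  define g' where "g' x = foldr reflection vs (g x)" for x
  have "\<exists>us. (\<forall>v\<in>set us. bil v v \<noteq> 0 \<and> (\<forall>a\<in>insert b A. bil v a = 0)) \<and>
    (\<forall>a\<in>insert b A \<union> set bs. foldr reflection us (g' a) = a)"
  proof (rule Cons.IH)
    show "bil (g' x) (g' y) = bil x y" for x y
      using vs Cons.prems(1) by (simp add: g'_def reflections_isometry)
    show "\<forall>a\<in>insert b A. g' a = a"
      using vs Cons.prems(2) by (auto simp: g'_def intro: reflections_fix)
    show "\<forall>c\<in>set bs. bil c c \<noteq> 0 \<and> (\<forall>a\<in>insert b A. bil c a = 0)"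
      using Cons.prems(3,4) by (auto intro: trans [OF bil_commute])
    show "sorted_wrt (\<lambda>b c. bil b c = 0) bs" using Cons.prems(4) by simp
  qed
  then obtain us where us: "\<forall>v\<in>set us. bil v v \<noteq> 0 \<and> (\<forall>a\<in>insert b A. bil v a = 0)"
    "\<forall>a\<in>insert b A \<union> set bs. foldr reflection us (g' a) = a" by blast
  then show ?case
    using vs by (intro exI [of _ "us @ vs"]) (auto simp: g'_def)
qed

text \<open>
  In place of the Gram--Schmidt procedure, one reflection maps \<open>h\<close> to a multiple of
  \<open>e\<^sub>1 + e\<^sub>2\<close>, whose complement has an obvious orthogonal basis; the same reflection brings this basis
  back.  Being a basis is expressed by the absence of a nonzero vector orthogonal to \<open>h\<close> and to the
  list.
\<close>

lemma orthogonal_complement_basis: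
  fixes h :: "real ^ 7"
  assumes "bil h h > 0"
  obtains bs where "\<forall>b\<in>set bs. bil b b \<noteq> 0 \<and> bil b h = 0" "sorted_wrt (\<lambda>b c. bil b c = 0) bs"
    "\<And>x. bil x h = 0 \<Longrightarrow> \<forall>b\<in>set bs. bil x b = 0 \<Longrightarrow> x = 0"
proof -
  define d :: "real ^ 7" where "d = unit_vec 1 + unit_vec 2"
  define ds :: "(real ^ 7) list" where
    "ds = [unit_vec 1 - unit_vec 2, unit_vec 3 + unit_vec 4, unit_vec 3 - unit_vec 4,
      unit_vec 5 + unit_vec 6, unit_vec 5 - unit_vec 6, unit_vec 7]"
  have ds: "\<forall>b\<in>set ds. bil b b \<noteq> 0 \<and> bil b d = 0" "sorted_wrt (\<lambda>b c. bil b c = 0) ds"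
    by (simp_all add: ds_def d_def)
  have ds_total: "x = 0" if "bil x d = 0" "\<forall>b\<in>set ds. bil x b = 0" for x
    using that by (simp add: ds_def d_def vec7_eq_iff)
  define c where "c = sqrt (bil h h / 2)"
  have c: "c \<noteq> 0" "c * c * 2 = bil h h" using assms by (simp_all add: c_def)
  have "\<exists>c'. c' \<noteq> 0 \<and> bil (c' *s d) (c' *s d) = bil h h \<and> bil (h - c' *s d) (h - c' *s d) \<noteq> 0"
  proof (cases "bil (h - c *s d) (h - c *s d) = 0")
    case False
    then show ?thesis using c by (intro exI [of _ c]) (simp add: d_def)
  next
    case True
    have "bil (h - c *s d) (h - c *s d) + bil (h - (- c) *s d) (h - (- c) *s d)
        = 2 * bil h h + 2 * (c * c * bil d d)"
      by (simp add: algebra_simps)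
    also have "\<dots> = 4 * bil h h" using c by (simp add: d_def)
    finally show ?thesis using c assms True by (intro exI [of _ "- c"]) (simp add: d_def)
  qed
  then obtain c' where c': "c' \<noteq> 0" "bil (c' *s d) (c' *s d) = bil h h"
    and nz: "bil (h - c' *s d) (h - c' *s d) \<noteq> 0" by blast
  define s where "s = reflection (h - c' *s d)"
  have sh: "s h = c' *s d" using c' nz by (simp add: s_def reflection_swap)
  have s_move: "bil x (s y) = bil (s x) y" for x y
    using reflection_isometry [OF nz, of "s x" y] reflection_involution [OF nz]
    by (simp add: s_def)
  have s_iso: "bil (s x) (s y) = bil x y" for x y
    unfolding s_def by (rule reflection_isometry [OF nz])
  have s_inv: "s (s x) = x" for x
    unfolding s_def by (rule reflection_involution [OF nz])
  have sd: "bil x d = bil (s x) h / c'" for x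
    using s_move [of x h] c' by (simp add: sh field_simps)
  show ?thesis
  proof (rule that [of "map s ds"])
    show "\<forall>b\<in>set (map s ds). bil b b \<noteq> 0 \<and> bil b h = 0"
      using ds(1) c' by (auto simp: s_iso sd)
    show "sorted_wrt (\<lambda>b c. bil b c = 0) (map s ds)"
      using ds(2) by (simp add: sorted_wrt_map s_iso)
    fix x assume x: "bil x h = 0" "\<forall>b\<in>set (map s ds). bil x b = 0"
    have "bil (s x) d = 0" using x(1) by (simp add: sd s_inv)
    moreover have "\<forall>b\<in>set ds. bil (s x) b = 0" using x(2) by (simp add: s_move)
    ultimately have "s x = 0" by (rule ds_total)
    then have "s (s x) = 0" by (simp add: s_def reflection_def)
    then show "x = 0" by (simp add: s_inv)
  qed
qed

lemma O_stab_mult: "g \<in> O_stab h \<Longrightarrow> g' \<in> O_stab h \<Longrightarrow> g ** g' \<in> O_stab h"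
  by (auto simp: O_stab_def O_L_mult simp flip: matrix_vector_mul_assoc)

lemma O_stab_inverse:
  assumes "g \<in> O_stab h"
  obtains g' where "g' \<in> O_stab h" "g ** g' = mat 1" "g' ** g = mat 1"
proof -
  obtain g' where g': "g' \<in> O_L" "g ** g' = mat 1" "g' ** g = mat 1"
    using assms O_L_inverse by (auto simp: O_stab_def)
  have "g' *v (g *v h) = h" by (simp add: matrix_vector_mul_assoc g')
  then have "g' \<in> O_stab h" using assms g' by (simp add: O_stab_def)
  then show ?thesis using that g' by blast
qed

lemma O_stab_ext_vec: "g \<in> O_stab h \<Longrightarrow> ext_map g (ext_vec h) = ext_vec h"
  by (simp add: ext_map_ext_vec O_stab_def)

lemma O_stab_perp:
  assumes "g \<in> O_stab h" "x \<in> perp h"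
  shows "ext_map g x \<in> perp h"
  using ext_map_bil [of g "ext_vec h" x] assms O_stab_ext_vec [OF assms(1), where 'a = 'a]
  by (simp add: perp_def O_stab_def)

lemma prod_list_sgn_unit:
  assumes "\<forall>v\<in>set vs. bil v v \<noteq> (0::real)"
  shows "(\<Prod>v\<leftarrow>vs. sgn (- bil v v / 2)) \<in> {1, - 1}"
  using assms by (induction vs) (auto simp: sgn_if)

text \<open>
  After composition with suitable reflections the isometry fixes \<open>h\<close> and an orthogonal basis of
  its complement, so it is the identity by nondegeneracy.  The factors are orthogonal to \<open>h\<close>
  throughout, as the definition of the spinor norm requires.
\<close>

lemma spinor_norm_exists:
  assumes "g \<in> O_stab h" "bil h h > 0"
  obtains \<epsilon> where "has_spinor_norm (perp h) (ext_map g) \<epsilon>" "\<epsilon> \<in> {1, - 1}"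
proof -
  let ?h = "ext_vec h :: real ^ 7"
  have pos: "bil ?h ?h > 0" using assms(2) by (simp add: bil_ext_vec)
  have iso: "bil (ext_map g x) (ext_map g y) = bil x y" for x y :: "real ^ 7"
    using assms(1) by (intro ext_map_bil) (simp add: O_stab_def)
  obtain bs where bs: "\<forall>b\<in>set bs. bil b b \<noteq> 0 \<and> bil b ?h = 0" "sorted_wrt (\<lambda>b c. bil b c = 0) bs"
    and total: "\<And>x. bil x ?h = 0 \<Longrightarrow> \<forall>b\<in>set bs. bil x b = 0 \<Longrightarrow> x = 0"
    using orthogonal_complement_basis [OF pos] by blast
  have "\<exists>vs. (\<forall>v\<in>set vs. bil v v \<noteq> 0 \<and> (\<forall>a\<in>{?h}. bil v a = 0)) \<and>
      (\<forall>a\<in>{?h} \<union> set bs. foldr reflection vs (ext_map g a) = a)"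
    by (rule reflections_restore_orthogonal_list)
      (use iso bs O_stab_ext_vec [OF assms(1)] in auto)
  then obtain vs where vs: "\<forall>v\<in>set vs. bil v v \<noteq> 0 \<and> bil v ?h = 0"
    and fix_vs: "\<forall>a\<in>{?h} \<union> set bs. foldr reflection vs (ext_map g a) = a" by auto
  define k where "k x = foldr reflection vs (ext_map g x)" for x
  have k_iso: "bil (k x) (k y) = bil x y" for x y
    using vs iso by (simp add: k_def reflections_isometry)
  have "k x = x" for x
  proof -
    have k_diff: "bil (k x - x) a = 0" if "a \<in> {?h} \<union> set bs" for a
    proof -
      have "k a = a" using fix_vs that by (simp only: k_def)
      then show ?thesis using k_iso [of x a] by (simp only: bil_linear diff_self)
    qed
    have "k x - x = 0" by (rule total) (use k_diff in blast)+
    then show ?thesis by simp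
  qed
  then have "ext_map g x = foldr reflection (rev vs) x" for x
    using reflections_rev [of vs "ext_map g x"] vs by (simp add: k_def)
  then have "has_spinor_norm (perp h) (ext_map g) (\<Prod>v\<leftarrow>rev vs. sgn (- bil v v / 2))"
    unfolding has_spinor_norm_def using vs
    by (intro exI [of _ "rev vs"]) (auto simp: perp_def bil_commute)
  then show ?thesis using that prod_list_sgn_unit [of "rev vs"] vs by auto
qed

lemma spinor_norm_mult:
  assumes "has_spinor_norm (perp h) (ext_map g) \<epsilon>" "has_spinor_norm (perp h) (ext_map g') \<epsilon>'"
    and "g' \<in> O_stab h"
  shows "has_spinor_norm (perp h) (ext_map (g ** g')) (\<epsilon> * \<epsilon>')"
proof -
  obtain vs vs' where
    vs: "\<forall>v\<in>set vs. v \<in> perp h \<and> bil v v \<noteq> 0" "\<forall>x\<in>perp h. ext_map g x = foldr reflection vs x"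
      "\<epsilon> = (\<Prod>v\<leftarrow>vs. sgn (- bil v v / 2))" and
    vs': "\<forall>v\<in>set vs'. v \<in> perp h \<and> bil v v \<noteq> 0" "\<forall>x\<in>perp h. ext_map g' x = foldr reflection vs' x"
      "\<epsilon>' = (\<Prod>v\<leftarrow>vs'. sgn (- bil v v / 2))"
    using assms(1,2) unfolding has_spinor_norm_def by blast
  have "ext_map (g ** g') x = foldr reflection (vs @ vs') x" if "x \<in> perp h" for x
    using vs(2) vs'(2) that O_stab_perp [OF assms(3) that] by (simp add: ext_map_mult)
  then show ?thesis
    unfolding has_spinor_norm_def using vs vs' by (intro exI [of _ "vs @ vs'"]) auto
qed

lemma spinor_norm_inverse:
  assumes "has_spinor_norm (perp h) (ext_map g) \<epsilon>" "g' \<in> O_stab h" "g ** g' = mat 1"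
  shows "has_spinor_norm (perp h) (ext_map g') \<epsilon>"
proof -
  obtain vs where
    vs: "\<forall>v\<in>set vs. v \<in> perp h \<and> bil v v \<noteq> 0" "\<forall>x\<in>perp h. ext_map g x = foldr reflection vs x"
      "\<epsilon> = (\<Prod>v\<leftarrow>vs. sgn (- bil v v / 2))"
    using assms(1) unfolding has_spinor_norm_def by blast
  have "ext_map g' x = foldr reflection (rev vs) x" if "x \<in> perp h" for x
  proof -
    have "foldr reflection vs (ext_map g' x) = ext_map g (ext_map g' x)"
      using vs(2) O_stab_perp [OF assms(2) that] by simp
    also have "\<dots> = x" by (simp add: assms(3) flip: ext_map_mult)
    finally show ?thesis using reflections_rev [of vs "ext_map g' x"] vs(1) by simp
  qed
  then show ?thesis
    unfolding has_spinor_norm_def using vs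
    by (intro exI [of _ "rev vs"]) (auto simp: rev_map [symmetric] prod_list.rev)
qed

lemma O_plus_mult: "g \<in> O_plus h \<Longrightarrow> g' \<in> O_plus h \<Longrightarrow> g ** g' \<in> O_plus h"
  using spinor_norm_mult [of h g 1 g' 1] by (simp add: O_plus_def O_stab_mult)

lemma O_plus_inverse:
  assumes "g \<in> O_plus h"
  obtains g' where "g' \<in> O_plus h" "g' ** g = mat 1"
proof -
  have g: "g \<in> O_stab h" "has_spinor_norm (perp h) (ext_map g) 1"
    using assms by (simp_all add: O_plus_def)
  obtain g' where "g' \<in> O_stab h" "g ** g' = mat 1" "g' ** g = mat 1"
    using O_stab_inverse [OF g(1)] .
  then show ?thesis using that spinor_norm_inverse [OF g(2)] unfolding O_plus_def by blast
qed

section \<open>Counting boundary curves\<close>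

lemma plane_equiv_class_eq:
  assumes "E \<in> isotropic_planes h" "E' \<in> isotropic_planes h" "g \<in> O_plus h" "ext_map g ` E = E'"
  shows "plane_equiv h `` {E} = plane_equiv h `` {E'}"
proof -
  obtain g' where g': "g' \<in> O_plus h" "g' ** g = mat 1" using O_plus_inverse assms(3) .
  have E: "E = ext_map g' ` E'"
    using assms(4) g'(2) by (auto simp: image_image simp flip: ext_map_mult)
  have "(\<exists>k\<in>O_plus h. F = ext_map k ` E) \<longleftrightarrow> (\<exists>k\<in>O_plus h. F = ext_map k ` E')" for F
  proof
    assume "\<exists>k\<in>O_plus h. F = ext_map k ` E"
    then obtain k where "k \<in> O_plus h" "F = ext_map k ` (ext_map g' ` E')" using E by metis
    then have "F = ext_map (k ** g') ` E'" by (simp add: image_image ext_map_mult)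
    then show "\<exists>k\<in>O_plus h. F = ext_map k ` E'" using O_plus_mult g' \<open>k \<in> _\<close> by blast
  next
    assume "\<exists>k\<in>O_plus h. F = ext_map k ` E'"
    then obtain k where "k \<in> O_plus h" "F = ext_map k ` (ext_map g ` E)" using assms(4) by metis
    then have "F = ext_map (k ** g) ` E" by (simp add: image_image ext_map_mult)
    then show "\<exists>k\<in>O_plus h. F = ext_map k ` E" using O_plus_mult assms(3) \<open>k \<in> _\<close> by blast
  qed
  then show ?thesis using assms(1,2) by (auto simp: plane_equiv_def)
qed

lemma card_quotient_le:
  assumes "finite S" "f ` A \<subseteq> S"
    and "\<And>x y. x \<in> A \<Longrightarrow> y \<in> A \<Longrightarrow> f x = f y \<Longrightarrow> r `` {x} = r `` {y}"
  shows "finite (A // r) \<and> card (A // r) \<le> card S"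
proof -
  have "A // r \<subseteq> (\<lambda>s. r `` {inv_into A f s}) ` (f ` A)"
  proof
    fix X assume "X \<in> A // r"
    then obtain x where x: "x \<in> A" "X = r `` {x}" by (auto simp: quotient_def)
    then have "X = r `` {inv_into A f (f x)}"
      by (metis assms(3) f_inv_into_f imageI inv_into_into)
    then show "X \<in> (\<lambda>s. r `` {inv_into A f s}) ` (f ` A)" using x(1) by blast
  qed
  moreover have fin: "finite (f ` A)" using assms finite_subset by blast
  ultimately have "finite (A // r)" "card (A // r) \<le> card (f ` A)"
    by (auto intro: finite_subset surj_card_le)
  then show ?thesis using card_mono [OF assms(1,2)] by linarith
qed

text \<open>
  To a plane are attached the normal form of \<open>h\<close> and a spinor norm of an element of \<open>O_stab h\<close>
  that carries a chosen plane with the same normal form to it.  Two planes for which both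
  coincide are related by a quotient of two such elements, whose spinor norm is a square, hence 1.
  The factor 2 in \<open>120 = 2 * 60\<close> accounts for the two spinor norms.
\<close>

lemma boundary_curves_bound:
  assumes "bil h h = 2 * (int n)\<^sup>2" "n > 0"
  shows "finite (boundary_curves h) \<and> card (boundary_curves h) \<le> 120 * n ^ 4"
proof -
  let ?P = "isotropic_planes h" and ?E0 = "vec.span {unit_vec 1, unit_vec 3} :: (rat ^ 7) set"
  have pos: "bil h h > 0" using assms by simp
  have "\<exists>g. g \<in> O_L \<and> ext_map g ` E = ?E0 \<and> g *v h \<in> normal_forms (int n)" if "E \<in> ?P" for E
  proof -
    have "isotropic_plane E" "E \<subseteq> perp h"
      using that by (simp_all add: isotropic_planes_def isotropic_plane_def)
    then show ?thesis
      using isotropic_plane_normal_form [of E h "int n"] assms by (metis of_nat_0_less_iff)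
  qed
  then obtain t where t: "\<And>E. E \<in> ?P \<Longrightarrow> t E \<in> O_L" "\<And>E. E \<in> ?P \<Longrightarrow> ext_map (t E) ` E = ?E0"
    "\<And>E. E \<in> ?P \<Longrightarrow> t E *v h \<in> normal_forms (int n)" by metis
  define base where "base E = inv_into ?P (\<lambda>E. t E *v h) (t E *v h)" for E
  have base: "base E \<in> ?P" "t (base E) *v h = t E *v h" if "E \<in> ?P" for E
    using that unfolding base_def
    by (auto intro: inv_into_into f_inv_into_f [of _ "\<lambda>E. t E *v h"])
  have "\<exists>k \<epsilon>. k \<in> O_stab h \<and> ext_map k ` base E = E \<and>
      has_spinor_norm (perp h) (ext_map k) \<epsilon> \<and> \<epsilon> \<in> {1, - 1}" if E: "E \<in> ?P" for E
  proof -
    obtain s where s: "s \<in> O_L" "s ** t E = mat 1" using O_L_inverse t(1) [OF E] by blast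
    define k where "k = s ** t (base E)"
    have "k *v h = s *v (t E *v h)"
      using base(2) [OF E] by (simp add: k_def flip: matrix_vector_mul_assoc)
    then have k: "k \<in> O_stab h"
      using s t(1) base(1) E
      by (simp add: O_stab_def k_def O_L_mult matrix_vector_mul_assoc)
    have "ext_map k ` base E = ext_map s ` (ext_map (t (base E)) ` base E)"
      by (simp add: k_def image_image ext_map_mult)
    also have "\<dots> = ext_map s ` (ext_map (t E) ` E)"
      using t(2) E base(1) by simp
    also have "\<dots> = E" by (simp add: image_image s flip: ext_map_mult)
    finally show ?thesis using k spinor_norm_exists [OF k pos] by metis
  qed
  then obtain k \<epsilon> where k: "\<And>E. E \<in> ?P \<Longrightarrow> k E \<in> O_stab h" "\<And>E. E \<in> ?P \<Longrightarrow> ext_map (k E) ` base E = E"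
    "\<And>E. E \<in> ?P \<Longrightarrow> has_spinor_norm (perp h) (ext_map (k E)) (\<epsilon> E)"
    "\<And>E. E \<in> ?P \<Longrightarrow> \<epsilon> E \<in> {1, - 1 :: real}" by metis
  let ?S = "normal_forms (int n) \<times> {1, - 1 :: real}"
  have "finite (?P // plane_equiv h) \<and> card (?P // plane_equiv h) \<le> card ?S"
  proof (rule card_quotient_le [where f = "\<lambda>E. (t E *v h, \<epsilon> E)"])
    show "finite ?S" using card_normal_forms assms(2) by simp
    show "(\<lambda>E. (t E *v h, \<epsilon> E)) ` ?P \<subseteq> ?S" using t(3) k(4) by auto
    fix E E' assume E: "E \<in> ?P" "E' \<in> ?P" and "(t E *v h, \<epsilon> E) = (t E' *v h, \<epsilon> E')"
    then have eq: "base E' = base E" "\<epsilon> E' = \<epsilon> E" by (simp_all add: base_def)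
    obtain s where s: "s \<in> O_stab h" "k E ** s = mat 1" "s ** k E = mat 1"
      using O_stab_inverse k(1) E(1) by blast
    have "has_spinor_norm (perp h) (ext_map (k E' ** s)) (\<epsilon> E * \<epsilon> E)"
      using k(3) [OF E(2)] spinor_norm_inverse [OF k(3) [OF E(1)] s(1,2)] s(1)
      by (simp add: spinor_norm_mult eq)
    moreover have "\<epsilon> E * \<epsilon> E = 1" using k(4) [OF E(1)] by auto
    ultimately have "k E' ** s \<in> O_plus h"
      using k(1) E(2) s(1) by (simp add: O_plus_def O_stab_mult)
    moreover have "ext_map (k E' ** s) ` E = E'"
    proof -
      have "ext_map s ` E = ext_map s ` (ext_map (k E) ` base E)" using k(2) E(1) by simp
      also have "\<dots> = base E'" by (simp add: image_image s eq flip: ext_map_mult)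
      finally have "ext_map (k E') ` (ext_map s ` E) = E'" using k(2) E(2) by simp
      then show ?thesis by (simp add: image_image ext_map_mult)
    qed
    ultimately show "plane_equiv h `` {E} = plane_equiv h `` {E'}"
      using plane_equiv_class_eq E by blast
  qed
  moreover have "card ?S \<le> 120 * n ^ 4"
    using card_normal_forms [OF assms(2)] by (simp add: card_cartesian_product)
  ultimately show ?thesis unfolding boundary_curves_def by linarith
qed

theorem theorem5p7:
  fixes p :: nat and h :: "int ^ 7"
  assumes "prime p" and "p > 3"
    and "split_vec h" and "bil h h = 2 * int p ^ 2"
  shows "finite (boundary_curves h) \<and> card (boundary_curves h) \<le> 160 * (p ^ 5 + p ^ 2)"
proof -
  have "120 * p ^ 4 \<le> 160 * p ^ 5"
    using assms(2) by (intro mult_le_mono power_increasing) auto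
  also have "\<dots> \<le> 160 * (p ^ 5 + p ^ 2)" by simp
  finally show ?thesis
    using boundary_curves_bound [of h p] assms(2,4) by linarith
qed

end
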